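(* Let $\mathcal{L} \subset \mathbb{S}^3$ be a net of conics of type $A$, $B^*$, $D^*$ or $E^*$. Then the reciprocal surface $\mathbb{P}\mathcal{L}^{-1} \subset \mathbb{P}^5$ is projectively equivalent to the Veronese surface in $\mathbb{P}^5$, i.e. some projective linear automorphism of $\mathbb{P}^5$ maps one onto the other.
   Context: Everything is over $\mathbb{C}$. $\mathbb{S}^3$ is the $6$-dimensional space of complex symmetric $3\times 3$ matrices, and $\mathbb{P}^5=\mathbb{P}\mathbb{S}^3$. A net of conics is a $3$-dimensional linear subspace of $\mathbb{S}^3$. It is regular if it contains an invertible matrix. The reciprocal surface $\mathbb{P}\mathcal{L}^{-1}\subset\mathbb{P}^5$ of a regular net $\mathcal{L}$ is the Zariski closure of $\mathbb{P}(\{A^{-1} \mid A\in\mathcal{L},\ \det A\neq 0\})$. A symmetric matrix $M$ is identified with the quadratic form $(x,y,z)M(x,y,z)^T$; e.g. $2xz$ is the matrix with entries $1$ at positions $(1,3),(3,1)$ and $0$ elsewhere. Two nets $\mathcal{L}_1,\mathcal{L}_2$ are congruent if $\mathcal{L}_2=g^T\mathcal{L}_1 g$ for some $g\in \mathrm{GL}(3,\mathbb{C})$. Types of nets (Wall's classification): a net is of a given type if it is congruent to a net spanned by the following generators. Type $A$: $y^2+2xz,\ 2yz,\ -x^2-2gy^2+cz^2+2gxz$ for some constants $c,g\in\mathbb{C}$ with $c\neq 0$, $c\neq -9g^2$. Type $B^*$: $y^2+2xz,\ 2yz,\ -x^2-2y^2+2xz$. Type $D^*$: $2xz,\ 2yz,\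 z^2+2xy$. Type $E^*$: $2xz,\ 2yz,\ 2xy$. The Veronese surface is the image of $\nu:\mathbb{P}^2\to\mathbb{P}^5=\mathbb{P}\mathbb{S}^3$, $v\mapsto vv^T$, i.e. the set of rank-one symmetric matrices up to scaling. *)

theory Defs
  imports "HOL-Analysis.Analysis"
begin

section \<open>Complex symmetric matrices and nets of conics\<close>

text \<open>The library equips \<open>complex^3^3\<close> only with a real scalar multiplication, so its structure
  as a vector space over the complex numbers is set up here.\<close>

definition mscale :: "complex \<Rightarrow> complex^3^3 \<Rightarrow> complex^3^3"  (infixr \<open>*m\<close> 75)
  where "c *m M = (\<chi> i j. c * M $ i $ j)"

global_interpretation cmat: vector_space "(*m)"
  by unfold_locales (simp_all add: mscale_def vec_eq_iff algebra_simps)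

definition Sym3 :: "(complex^3^3) set"
  where "Sym3 = {M. transpose M = M}"

definition is_net :: "(complex^3^3) set \<Rightarrow> bool"
  where "is_net L \<longleftrightarrow> cmat.subspace L \<and> L \<subseteq> Sym3 \<and> cmat.dim L = 3"

definition congruent_nets :: "(complex^3^3) set \<Rightarrow> (complex^3^3) set \<Rightarrow> bool"
  where "congruent_nets L\<^sub>1 L\<^sub>2 \<longleftrightarrow>
    (\<exists>g :: complex^3^3. invertible g \<and> L\<^sub>2 = (\<lambda>M. transpose g ** M ** g) ` L\<^sub>1)"

definition quad_form :: "complex^3^3 \<Rightarrow> complex \<Rightarrow> complex \<Rightarrow> complex \<Rightarrow> complex"
  where "quad_form M x y z =
    (let v = vector [x, y, z] :: complex^3 in \<Sum>i\<in>UNIV. v $ i * (M *v v) $ i)"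

text \<open>The symmetric matrix identified with a quadratic form in three variables; the two lemmas
  below show that the description is proper on quadratic forms and compute its value.\<close>

definition form_matrix :: "(complex \<Rightarrow> complex \<Rightarrow> complex \<Rightarrow> complex) \<Rightarrow> complex^3^3"
  where "form_matrix q = (THE M. M \<in> Sym3 \<and> (\<forall>x y z. quad_form M x y z = q x y z))"

lemma form_matrix_quad_form:
  assumes "M \<in> Sym3"
  shows "form_matrix (quad_form M) = M"
  unfolding form_matrix_def
proof (rule the_equality)
  show "M \<in> Sym3 \<and> (\<forall>x y z. quad_form M x y z = quad_form M x y z)"
    using assms by simp
next
  fix N assume N: "N \<in> Sym3 \<and> (\<forall>x y z. quad_form N x y z = quad_form M x y z)"
  have sym: "K $ j $ i = K $ i $ j" if "K \<in> Sym3" for K i j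
    using that by (metis (mono_tags) Sym3_def mem_Collect_eq transpose_def vec_lambda_beta)
  have q: "quad_form K x y z = x^2 * K$1$1 + y^2 * K$2$2 + z^2 * K$3$3
      + 2 * x * y * K$1$2 + 2 * x * z * K$1$3 + 2 * y * z * K$2$3" if "K \<in> Sym3" for K x y z
    using sym[OF that, of 2 1] sym[OF that, of 3 1] sym[OF that, of 3 2]
    by (simp add: quad_form_def Let_def matrix_vector_mult_def sum_3 power2_eq_square algebra_simps)
  have e: "x^2 * N$1$1 + y^2 * N$2$2 + z^2 * N$3$3
      + 2 * x * y * N$1$2 + 2 * x * z * N$1$3 + 2 * y * z * N$2$3
    = x^2 * M$1$1 + y^2 * M$2$2 + z^2 * M$3$3
      + 2 * x * y * M$1$2 + 2 * x * z * M$1$3 + 2 * y * z * M$2$3" for x y z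
    using N q[OF assms, of x y z] q[of N x y z] by simp
  have d: "N$1$1 = M$1$1" "N$2$2 = M$2$2" "N$3$3 = M$3$3"
    using e[of 1 0 0] e[of 0 1 0] e[of 0 0 1] by simp_all
  have o: "N$1$2 = M$1$2" "N$1$3 = M$1$3" "N$2$3 = M$2$3"
    using e[of 1 1 0] e[of 1 0 1] e[of 0 1 1] d by simp_all
  show "N = M"
    using d o sym[of N 2 1] sym[of N 3 1] sym[of N 3 2] N
      sym[OF assms, of 2 1] sym[OF assms, of 3 1] sym[OF assms, of 3 2]
    by (simp add: vec_eq_iff forall_3)
qed

lemma form_matrix_eq:
  "form_matrix (\<lambda>x y z. a*x^2 + b*y^2 + c*z^2 + 2*d*x*y + 2*e*x*z + 2*f*y*z)
    = vector [vector [a, d, e], vector [d, b, f], vector [e, f, c]]"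
proof -
  let ?M = "vector [vector [a, d, e], vector [d, b, f], vector [e, f, c]] :: complex^3^3"
  have "?M \<in> Sym3"
    by (simp add: Sym3_def transpose_def vec_eq_iff forall_3)
  moreover have "quad_form ?M =
      (\<lambda>x y z. a*x^2 + b*y^2 + c*z^2 + 2*d*x*y + 2*e*x*z + 2*f*y*z)"
    by (intro ext) (simp add: quad_form_def Let_def matrix_vector_mult_def sum_3
        power2_eq_square algebra_simps)
  ultimately show ?thesis
    using form_matrix_quad_form[of ?M] by simp
qed

definition type_A :: "(complex^3^3) set \<Rightarrow> bool"
  where "type_A L \<longleftrightarrow> (\<exists>c g :: complex. c \<noteq> 0 \<and> c \<noteq> - 9 * g^2 \<and>
    congruent_nets L (cmat.span
      {form_matrix (\<lambda>x y z. y^2 + 2*x*z),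
       form_matrix (\<lambda>x y z. 2*y*z),
       form_matrix (\<lambda>x y z. - (x^2) - 2*g*y^2 + c*z^2 + 2*g*x*z)}))"

definition type_B_star :: "(complex^3^3) set \<Rightarrow> bool"
  where "type_B_star L \<longleftrightarrow> congruent_nets L (cmat.span
      {form_matrix (\<lambda>x y z. y^2 + 2*x*z),
       form_matrix (\<lambda>x y z. 2*y*z),
       form_matrix (\<lambda>x y z. - (x^2) - 2*y^2 + 2*x*z)})"

definition type_D_star :: "(complex^3^3) set \<Rightarrow> bool"
  where "type_D_star L \<longleftrightarrow> congruent_nets L (cmat.span
      {form_matrix (\<lambda>x y z. 2*x*z),
       form_matrix (\<lambda>x y z. 2*y*z),
       form_matrix (\<lambda>x y z. z^2 + 2*x*y)})"

definition type_E_star :: "(complex^3^3) set \<Rightarrow> bool"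
  where "type_E_star L \<longleftrightarrow> congruent_nets L (cmat.span
      {form_matrix (\<lambda>x y z. 2*x*z),
       form_matrix (\<lambda>x y z. 2*y*z),
       form_matrix (\<lambda>x y z. 2*x*y)})"


section \<open>The projective space of symmetric matrices\<close>

text \<open>A point of projective space is a one-dimensional complex subspace.  \<open>Proj X\<close> is the set of
  points represented by the nonzero elements of \<open>X\<close>.\<close>

definition Proj :: "(complex^3^3) set \<Rightarrow> (complex^3^3) set set"
  where "Proj X = {cmat.span {M} | M. M \<in> X \<and> M \<noteq> 0}"

abbreviation P5 :: "(complex^3^3) set set"
  where "P5 \<equiv> Proj Sym3"

text \<open>Homogeneous polynomials of degree \<open>d\<close> in the matrix entries, as functions (the field being
  infinite, nothing is lost).  The nine entries restrict on \<open>Sym3\<close> to its six coordinates.\<close>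

inductive hom_poly :: "nat \<Rightarrow> (complex^3^3 \<Rightarrow> complex) \<Rightarrow> bool" where
  const: "hom_poly 0 (\<lambda>M. c)"
| entry: "hom_poly 1 (\<lambda>M. M $ i $ j)"
| add: "hom_poly d p \<Longrightarrow> hom_poly d q \<Longrightarrow> hom_poly d (\<lambda>M. p M + q M)"
| mult: "hom_poly d p \<Longrightarrow> hom_poly e q \<Longrightarrow> hom_poly (d + e) (\<lambda>M. p M * q M)"

definition zariski_closed :: "(complex^3^3) set set \<Rightarrow> bool"
  where "zariski_closed Z \<longleftrightarrow>
    (\<exists>F. (\<forall>p\<in>F. \<exists>d. hom_poly d p) \<and> Z = {P \<in> P5. \<forall>p\<in>F. \<forall>M\<in>P. p M = 0})"

definition reciprocal_surface :: "(complex^3^3) set \<Rightarrow> (complex^3^3) set set"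
  where "reciprocal_surface L =
    zariski_closed hull Proj {matrix_inv A | A. A \<in> L \<and> det A \<noteq> 0}"

definition veronese_surface :: "(complex^3^3) set set"
  where "veronese_surface =
    {cmat.span {(columnvector v :: complex^1^3) ** (rowvector v :: complex^3^1)} | v. v \<noteq> 0}"

text \<open>Every linear automorphism of \<open>Sym3\<close> extends to a linear map on \<open>complex^3^3\<close>, so it can be
  represented by such a linear map that restricts to a bijection of \<open>Sym3\<close>.\<close>

definition projective_automorphism :: "((complex^3^3) set \<Rightarrow> (complex^3^3) set) \<Rightarrow> bool"
  where "projective_automorphism \<phi> \<longleftrightarrow>
    (\<exists>T. Vector_Spaces.linear (*m) (*m) T \<and> bij_betw T Sym3 Sym3 \<and> (\<forall>P\<in>P5. \<phi> P = T ` P))"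

definition projectively_equivalent :: "(complex^3^3) set set \<Rightarrow> (complex^3^3) set set \<Rightarrow> bool"
  where "projectively_equivalent X Y \<longleftrightarrow> (\<exists>\<phi>. projective_automorphism \<phi> \<and> \<phi> ` X = Y)"

end

theory Submission
  imports Defs "HOL-Computational_Algebra.Polynomial"
begin

text \<open>Parametrise a net by a linear map \<open>B\<close> on \<open>\<complex>\<^sup>3\<close>. The entries of the adjugate of \<open>B v\<close> are six
  quadratic forms in \<open>v\<close>, which for the nets in question are linearly independent. So
  the adjugate of \<open>B v\<close> equals \<open>T (v v\<^sup>T)\<close> for a linear automorphism \<open>T\<close> of the symmetric matrices,
  and the inverses of the elements of the net fill the part of \<open>T\<close>(Veronese surface) where
  \<open>det (B v) \<noteq> 0\<close>. This part is dense because a polynomial that vanishes at all but finitely many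
  points of a line vanishes on the line, and the whole is closed, being cut out by the \<open>2 \<times> 2\<close>
  minors of \<open>T\<^sup>-\<^sup>1\<close>. A congruence of nets only composes \<open>T\<close> with another automorphism.\<close>

section \<open>Polynomial functions of one variable\<close>

definition poly_fun :: "(complex \<Rightarrow> complex) \<Rightarrow> bool"
  where "poly_fun f \<longleftrightarrow> (\<exists>q. f = poly q)"

lemma poly_fun_const [intro]: "poly_fun (\<lambda>t. c)"
  unfolding poly_fun_def by (rule exI[of _ "[:c:]"]) auto

lemma poly_fun_affine [intro]: "poly_fun (\<lambda>t. a + t * b)"
  unfolding poly_fun_def by (rule exI[of _ "[:a, b:]"]) auto

lemma poly_fun_add [intro]: "poly_fun f \<Longrightarrow> poly_fun g \<Longrightarrow> poly_fun (\<lambda>t. f t + g t)"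
  unfolding poly_fun_def
proof (elim exE)
  fix p q assume "f = poly p" "g = poly q"
  then have "(\<lambda>t. f t + g t) = poly (p + q)" by (simp add: fun_eq_iff)
  then show "\<exists>q. (\<lambda>t. f t + g t) = poly q" by blast
qed

lemma poly_fun_mult [intro]: "poly_fun f \<Longrightarrow> poly_fun g \<Longrightarrow> poly_fun (\<lambda>t. f t * g t)"
  unfolding poly_fun_def
proof (elim exE)
  fix p q assume "f = poly p" "g = poly q"
  then have "(\<lambda>t. f t * g t) = poly (p * q)" by (simp add: fun_eq_iff)
  then show "\<exists>q. (\<lambda>t. f t * g t) = poly q" by blast
qed

lemma poly_fun_sum [intro]: "(\<And>i. i \<in> I \<Longrightarrow> poly_fun (f i)) \<Longrightarrow> poly_fun (\<lambda>t. \<Sum>i\<in>I. f i t)"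
  by (induction I rule: infinite_finite_induct) auto

text \<open>The polynomial ring is an integral domain: \<open>g\<close> is not the zero polynomial,
  so \<open>f\<close> must be. In this form, vanishing away from the zeros of \<open>g\<close>
  extends to the whole line.\<close>

lemma poly_fun_mult_eq_0:
  assumes "poly_fun f" "poly_fun g" "\<And>t. f t * g t = 0" "g s \<noteq> 0"
  shows "f t = 0"
proof -
  obtain p q where pq: "f = poly p" "g = poly q"
    using assms(1,2) unfolding poly_fun_def by blast
  then have "poly (p * q) t = 0" for t
    using assms(3) by simp
  then have "p * q = 0"
    using poly_all_0_iff_0 by blast
  then show ?thesis
    using assms(4) pq by auto
qed

lemma hom_poly_poly_fun:
  assumes "hom_poly d p" and "\<And>i j. poly_fun (\<lambda>t. M t $ i $ j)"
  shows "poly_fun (\<lambda>t. p (M t))"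
  using assms(1) by induction (auto intro: assms(2))

lemma hom_poly_sum:
  "finite I \<Longrightarrow> (\<And>i. i \<in> I \<Longrightarrow> hom_poly d (f i)) \<Longrightarrow> hom_poly d (\<lambda>M. \<Sum>i\<in>I. f i M)"
proof (induction I rule: finite_induct)
  case empty
  \<comment> \<open>The empty sum requires the zero function to have degree \<open>d\<close>; it
    arises as any form of degree \<open>d\<close> times the constant 0.\<close>
  have "hom_poly (d + 0) (\<lambda>M. p M * 0)" if "hom_poly d p" for p
    by (rule hom_poly.mult[OF that hom_poly.const])
  moreover have "\<exists>p. hom_poly d p"
  proof (induction d)
    case (Suc d)
    then show ?case
      using hom_poly.mult[OF hom_poly.entry] by (metis plus_1_eq_Suc)
  qed (blast intro: hom_poly.const)
  ultimately show ?case by auto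
qed (auto intro: hom_poly.add)

section \<open>Linear maps on symmetric matrices\<close>

lemma mscale_nth [simp]: "(c *m M) $ i $ j = c * M $ i $ j"
  by (simp add: mscale_def)

lemma Sym3_nth: "M \<in> Sym3 \<longleftrightarrow> (\<forall>i j. M $ j $ i = M $ i $ j)"
  by (auto simp: Sym3_def transpose_def vec_eq_iff)

lemma span_singleton_mscale:
  assumes "c \<noteq> 0"
  shows "cmat.span {c *m M} = cmat.span {M}"
  using assms
  by (intro subset_antisym cmat.span_minimal cmat.subspace_span)
    (auto simp: cmat.span_singleton image_iff intro: exI[of _ "1 / c"])

lemma linear_image_span_singleton:
  assumes "Vector_Spaces.linear (*m) (*m) S"
  shows "S ` cmat.span {M} = cmat.span {S M}"
proof -
  interpret S: Vector_Spaces.linear "(*m)" "(*m)" S by (rule assms)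
  show ?thesis
    unfolding cmat.span_singleton by (auto simp: S.scale image_iff)
qed

text \<open>Expanding \<open>M\<close> in the matrix units exhibits the entries of
  \<open>S M\<close> as linear forms in the entries of \<open>M\<close>.\<close>

lemma linear_nth:
  assumes "Vector_Spaces.linear (*m) (*m) S"
  shows "S M $ i $ j = (\<Sum>k\<in>UNIV. \<Sum>l\<in>UNIV. M $ k $ l * S (\<chi> a b. of_bool (a = k \<and> b = l)) $ i $ j)"
proof -
  interpret S: Vector_Spaces.linear "(*m)" "(*m)" S by (rule assms)
  have "M = (\<Sum>k\<in>UNIV. \<Sum>l\<in>UNIV. M $ k $ l *m (\<chi> a b. of_bool (a = k \<and> b = l)))"
    by (auto simp: vec_eq_iff sum_3 forall_3)
  then have "S M = S (\<Sum>k\<in>UNIV. \<Sum>l\<in>UNIV. M $ k $ l *m (\<chi> a b. of_bool (a = k \<and> b = l)))"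
    by (rule arg_cong)
  then show ?thesis
    by (simp add: S.sum S.scale)
qed

lemma linear_hom_poly:
  assumes "Vector_Spaces.linear (*m) (*m) S"
  shows "hom_poly 1 (\<lambda>M. S M $ i $ j)"
proof -
  have "hom_poly 1 (\<lambda>M. M $ k $ l * c)" for k l c
    using hom_poly.mult[OF hom_poly.entry[of k l] hom_poly.const[of c]] by simp
  then show ?thesis
    by (subst ext[OF linear_nth[OF assms]]) (intro hom_poly_sum finite)
qed

section \<open>Rank-one symmetric matrices and linear images of the Veronese surface\<close>

definition veronese :: "complex^3 \<Rightarrow> complex^3^3"
  where "veronese v = (columnvector v :: complex^1^3) ** (rowvector v :: complex^3^1)"

lemma veronese_nth [simp]: "veronese v $ i $ j = v $ i * v $ j"
  by (simp add: veronese_def matrix_matrix_mult_def columnvector_def rowvector_def)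

lemma veronese_Sym3: "veronese v \<in> Sym3"
  by (simp add: Sym3_nth)

lemma veronese_eq_0_iff: "veronese v = 0 \<longleftrightarrow> v = 0"
  by (auto simp: vec_eq_iff)

text \<open>If some diagonal entry is nonzero, the minors through it express every entry by row
  \<open>i\<close>, and \<open>v\<close> is this row divided by a square root of
  \<open>K $ i $ i\<close>. If the diagonal vanishes, the principal minors force the square of each
  off-diagonal entry to be 0.\<close>

lemma veronese_if_minors_eq_0:
  assumes "K \<in> Sym3" and minors: "\<And>i j k l. K $ i $ j * K $ k $ l = K $ i $ l * K $ k $ j"
  shows "\<exists>v. K = veronese v"
proof (cases "\<exists>i. K $ i $ i \<noteq> 0")
  case True
  then obtain i where i: "K $ i $ i \<noteq> 0" by blast
  have "K = veronese (\<chi> j. K $ i $ j / csqrt (K $ i $ i))"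
    using i minors[of _ _ i i] assms(1)
    by (simp add: vec_eq_iff Sym3_nth field_simps flip: power2_eq_square)
  then show ?thesis by blast
next
  case False
  then have "K = veronese 0"
    using minors[of i i j j for i j] assms(1) by (simp add: vec_eq_iff Sym3_nth)
  then show ?thesis by blast
qed

text \<open>The equations defining \<open>Z\<close> are among the forms vanishing on
  \<open>Z\<close>, so testing the latter suffices. The scalar \<open>c\<close> appears because
  \<open>zariski_closed\<close> tests every representative of a point.\<close>

lemma span_mem_zariski_closed:
  assumes "zariski_closed Z" "M \<in> Sym3" "M \<noteq> 0"
    and vanish: "\<And>p e c. hom_poly e p \<Longrightarrow> (\<And>P N. P \<in> Z \<Longrightarrow> N \<in> P \<Longrightarrow> p N = 0) \<Longrightarrow> p (c *m M) = 0"
  shows "cmat.span {M} \<in> Z"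
proof -
  obtain F where F: "\<And>p. p \<in> F \<Longrightarrow> \<exists>e. hom_poly e p"
    and Z: "\<And>P. P \<in> Z \<longleftrightarrow> P \<in> P5 \<and> (\<forall>p\<in>F. \<forall>M\<in>P. p M = 0)"
    using assms(1) unfolding zariski_closed_def by blast
  have "p (c *m M) = 0" if "p \<in> F" for p c
  proof -
    from F[OF that] obtain e where "hom_poly e p" ..
    then show ?thesis
      by (rule vanish) (use Z that in blast)
  qed
  moreover have "cmat.span {M} \<in> P5"
    unfolding Proj_def using assms(2,3) by blast
  ultimately show ?thesis
    unfolding Z cmat.span_singleton by blast
qed

text \<open>\<open>T\<close> and \<open>S\<close> act on all matrices, as
  \<open>projective_automorphism\<close> demands, but are mutually inverse only on
  \<open>Sym3\<close>. The inverse is carried along because it supplies both the equations of the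
  image of the Veronese surface and the projective equivalence.\<close>

locale Sym3_automorphism =
  fixes T S :: "complex^3^3 \<Rightarrow> complex^3^3"
  assumes linear_T: "Vector_Spaces.linear (*m) (*m) T"
    and linear_S: "Vector_Spaces.linear (*m) (*m) S"
    and T_Sym3: "M \<in> Sym3 \<Longrightarrow> T M \<in> Sym3"
    and S_Sym3: "M \<in> Sym3 \<Longrightarrow> S M \<in> Sym3"
    and S_T: "M \<in> Sym3 \<Longrightarrow> S (T M) = M"
    and T_S: "M \<in> Sym3 \<Longrightarrow> T (S M) = M"
begin

sublocale T: Vector_Spaces.linear "(*m)" "(*m)" T by (rule linear_T)
sublocale S: Vector_Spaces.linear "(*m)" "(*m)" S by (rule linear_S)

lemma bij_betw_S: "bij_betw S Sym3 Sym3"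
  by (rule bij_betw_byWitness[where f' = T]) (auto simp: T_Sym3 S_Sym3 S_T T_S)

lemma T_veronese_eq_0_iff: "T (veronese v) = 0 \<longleftrightarrow> v = 0"
  by (metis S.zero S_T T.zero veronese_Sym3 veronese_eq_0_iff)

text \<open>A nonzero symmetric \<open>M\<close> represents a point of this set exactly when
  \<open>S M\<close> has rank one, which the 2x2 minors of \<open>S M\<close> detect; they are
  quadrics in \<open>M\<close> since \<open>S\<close> is linear.\<close>

lemma zariski_closed_T_veronese: "zariski_closed {cmat.span {T (veronese v)} | v. v \<noteq> 0}"
proof -
  \<comment> \<open>The difference is written with a factor -1 because \<open>hom_poly\<close> is
    generated by sums and products.\<close>
  define minor where "minor i j k l M = S M $ i $ j * S M $ k $ l + (-1) * (S M $ i $ l * S M $ k $ j)"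
    for i j k l M
  define F where "F = {minor i j k l | i j k l. True}"
  have "hom_poly (0 + (1 + 1)) (\<lambda>M. (-1) * (S M $ i $ l * S M $ k $ j))" for i k l j
    by (rule hom_poly.mult[OF hom_poly.const
          hom_poly.mult[OF linear_hom_poly[OF linear_S] linear_hom_poly[OF linear_S]]])
  moreover have "hom_poly (1 + 1) (\<lambda>M. S M $ i $ j * S M $ k $ l)" for i j k l
    by (rule hom_poly.mult[OF linear_hom_poly[OF linear_S] linear_hom_poly[OF linear_S]])
  ultimately have "hom_poly 2 (minor i j k l)" for i j k l
    unfolding minor_def by (intro hom_poly.add) (simp_all flip: one_add_one)
  then have "\<exists>d. hom_poly d p" if "p \<in> F" for p
    using that unfolding F_def by blast
  moreover have "{cmat.span {T (veronese v)} | v. v \<noteq> 0} = {P \<in> P5. \<forall>p\<in>F. \<forall>M\<in>P. p M = 0}"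
  proof (intro equalityI subsetI)
    fix P assume "P \<in> {cmat.span {T (veronese v)} | v. v \<noteq> 0}"
    then obtain v where v: "P = cmat.span {T (veronese v)}" "v \<noteq> 0" by blast
    have "P \<in> P5"
      unfolding Proj_def using v T_veronese_eq_0_iff T_Sym3 veronese_Sym3 by blast
    moreover have "minor i j k l (c *m T (veronese v)) = 0" for i j k l c
      by (simp add: minor_def S.scale S_T veronese_Sym3)
    then have "\<forall>p\<in>F. \<forall>M\<in>P. p M = 0"
      unfolding F_def v cmat.span_singleton by auto
    ultimately show "P \<in> {P \<in> P5. \<forall>p\<in>F. \<forall>M\<in>P. p M = 0}" by blast
  next
    fix P assume P: "P \<in> {P \<in> P5. \<forall>p\<in>F. \<forall>M\<in>P. p M = 0}"
    then obtain M where M: "P = cmat.span {M}" "M \<in> Sym3" "M \<noteq> 0"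
      unfolding Proj_def by blast
    then have "minor i j k l M = 0" for i j k l
      using P cmat.span_base[of M "{M}"] unfolding F_def by blast
    then obtain v where "S M = veronese v"
      using veronese_if_minors_eq_0[OF S_Sym3[OF M(2)]] unfolding minor_def by auto
    then have "M = T (veronese v)"
      using T_S M by metis
    then show "P \<in> {cmat.span {T (veronese v)} | v. v \<noteq> 0}"
      using M T_veronese_eq_0_iff by blast
  qed
  ultimately show ?thesis
    unfolding zariski_closed_def by blast
qed

lemma projectively_equivalent_T_veronese:
  "projectively_equivalent {cmat.span {T (veronese v)} | v. v \<noteq> 0} veronese_surface"
proof -
  have "S ` cmat.span {T (veronese v)} = cmat.span {veronese v}" for v
    by (simp add: linear_image_span_singleton[OF linear_S] S_T veronese_Sym3)
  then have "(`) S ` {cmat.span {T (veronese v)} | v. v \<noteq> 0} = {cmat.span {veronese v} | v. v \<noteq> 0}"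
    by (simp add: setcompr_eq_image image_image)
  moreover have "projective_automorphism ((`) S)"
    unfolding projective_automorphism_def
    by (intro exI[of _ S] conjI linear_S bij_betw_S ballI refl)
  ultimately show ?thesis
    unfolding projectively_equivalent_def veronese_surface_def veronese_def[symmetric]
    by (intro exI[of _ "(`) S"] conjI)
qed

end

section \<open>Nets with a quadratic parametrisation of the inverses\<close>

lemma matrix_inv_unique:
  fixes A B :: "complex^3^3"
  assumes "A ** B = mat 1"
  shows "matrix_inv A = B"
  unfolding matrix_inv_def
proof (rule some_equality)
  show "A ** B = mat 1 \<and> B ** A = mat 1"
    using assms matrix_left_right_inverse by blast
  show "C = B" if "A ** C = mat 1 \<and> C ** A = mat 1" for C
    by (metis assms that matrix_mul_assoc matrix_mul_lid matrix_mul_rid)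
qed

lemma matrix_add_rdistrib:
  fixes A B C :: "complex^3^3"
  shows "(A + B) ** C = A ** C + B ** C"
  by (simp add: vec_eq_iff matrix_matrix_mult_def sum.distrib distrib_right)

lemma mscale_matrix_mult: "(c *m A) ** B = c *m (A ** B)" "A ** (c *m B) = c *m (A ** B)"
  by (simp_all add: vec_eq_iff matrix_matrix_mult_def sum_distrib_left mult_ac)

text \<open>The model for \<open>mult_T\<close> is the identity of a matrix with its adjugate,
  \<open>d\<close> being the determinant. A congruence multiplies the determinant by a nonzero
  constant, so \<open>d\<close> is left as a free function that need not change.\<close>

locale reciprocal_param = Sym3_automorphism T S
  for T S :: "complex^3^3 \<Rightarrow> complex^3^3" +
  fixes B\<^sub>1 B\<^sub>2 B\<^sub>3 :: "complex^3^3" and d :: "complex^3 \<Rightarrow> complex"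
  assumes mult_T: "(v$1 *m B\<^sub>1 + v$2 *m B\<^sub>2 + v$3 *m B\<^sub>3) ** T (veronese v) = d v *m mat 1"
    and regular: "\<exists>w. d w \<noteq> 0"
begin

definition B :: "complex^3 \<Rightarrow> complex^3^3"
  where "B v = v$1 *m B\<^sub>1 + v$2 *m B\<^sub>2 + v$3 *m B\<^sub>3"

lemma B_mult_T: "B v ** T (veronese v) = d v *m mat 1"
  using mult_T by (simp add: B_def)

lemma span_eq_range_B: "cmat.span {B\<^sub>1, B\<^sub>2, B\<^sub>3} = range B"
proof (intro equalityI subsetI)
  fix M assume "M \<in> cmat.span {B\<^sub>1, B\<^sub>2, B\<^sub>3}"
  then obtain a b c where "M = a *m B\<^sub>1 + b *m B\<^sub>2 + c *m B\<^sub>3"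
    by (auto simp: cmat.span_insert cmat.span_singleton algebra_simps)
  then have "M = B (vector [a, b, c])"
    by (simp add: B_def)
  then show "M \<in> range B" by blast
next
  have "B v \<in> cmat.span {B\<^sub>1, B\<^sub>2, B\<^sub>3}" for v
    unfolding B_def by (intro cmat.span_add cmat.span_scale cmat.span_base insertI1 insertI2)
  then show "M \<in> cmat.span {B\<^sub>1, B\<^sub>2, B\<^sub>3}" if "M \<in> range B" for M
    using that by blast
qed

lemma matrix_inv_B:
  assumes "d v \<noteq> 0"
  shows "matrix_inv (B v) = (1 / d v) *m T (veronese v)"
  using assms by (intro matrix_inv_unique) (simp add: mscale_matrix_mult B_mult_T)

text \<open>For \<open>d v \<noteq> 0\<close> the inverse of \<open>B v\<close> is explicit. If
  \<open>d v = 0\<close>, an inverse of \<open>B v\<close> would annihilate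
  \<open>T (veronese v)\<close>; injectivity then gives \<open>v = 0\<close>, hence
  \<open>B v = 0\<close>, which is singular.\<close>

lemma det_B_eq_0_iff: "det (B v) = 0 \<longleftrightarrow> d v = 0"
proof
  assume "det (B v) = 0"
  moreover have "B v ** ((1 / d v) *m T (veronese v)) = mat 1" if "d v \<noteq> 0"
    using that by (simp add: mscale_matrix_mult B_mult_T)
  ultimately show "d v = 0"
    using invertible_det_nz invertible_right_inverse by blast
next
  assume "d v = 0"
  then have eq: "B v ** T (veronese v) = 0"
    using B_mult_T by simp
  show "det (B v) = 0"
  proof (rule ccontr)
    assume "det (B v) \<noteq> 0"
    then obtain C where "C ** B v = mat 1"
      using invertible_det_nz invertible_left_inverse by blast
    then have "T (veronese v) = C ** (B v ** T (veronese v))"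
      by (simp add: matrix_mul_assoc)
    also have "\<dots> = 0"
      by (simp add: eq)
    finally have "B v = 0"
      by (simp add: T_veronese_eq_0_iff B_def)
    then show False
      using \<open>det (B v) \<noteq> 0\<close> by (simp add: det_3)
  qed
qed

lemma Proj_inverses:
  "Proj {matrix_inv A | A. A \<in> range B \<and> det A \<noteq> 0} = {cmat.span {T (veronese v)} | v. d v \<noteq> 0}"
proof -
  have "Proj {matrix_inv A | A. A \<in> range B \<and> det A \<noteq> 0}
      = {cmat.span {matrix_inv (B v)} | v. d v \<noteq> 0 \<and> matrix_inv (B v) \<noteq> 0}"
    unfolding Proj_def by (auto simp flip: det_B_eq_0_iff)
  also have "\<dots> = {cmat.span {T (veronese v)} | v. d v \<noteq> 0}"
  proof (intro Collect_cong ex_cong1)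
    fix P v
    have "v \<noteq> 0" if "d v \<noteq> 0"
      using that det_B_eq_0_iff[of v] by (auto simp: B_def det_3)
    then show "P = cmat.span {matrix_inv (B v)} \<and> d v \<noteq> 0 \<and> matrix_inv (B v) \<noteq> 0
        \<longleftrightarrow> P = cmat.span {T (veronese v)} \<and> d v \<noteq> 0"
      by (auto simp: matrix_inv_B span_singleton_mscale T_veronese_eq_0_iff)
  qed
  finally show ?thesis .
qed

text \<open>Density by restriction to the line from \<open>v\<close> (at \<open>t = 0\<close>) to a
  point \<open>w\<close> with \<open>d w \<noteq> 0\<close> (at \<open>t = 1\<close>): the product
  of \<open>p\<close> and \<open>d\<close> is identically zero there, while \<open>d\<close> is
  not.\<close>

lemma hom_poly_eq_0:
  assumes "hom_poly e p" and "\<And>v. d v \<noteq> 0 \<Longrightarrow> p (c *m T (veronese v)) = 0"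
  shows "p (c *m T (veronese v)) = 0"
proof -
  obtain w where w: "d w \<noteq> 0" using regular by blast
  define u where "u t = v + (\<chi> i. t * (w $ i - v $ i))" for t
  have u: "poly_fun (\<lambda>t. u t $ i)" for i
    unfolding u_def by auto
  have N: "poly_fun (\<lambda>t. T (veronese (u t)) $ i $ j)" for i j
    by (rule hom_poly_poly_fun[OF linear_hom_poly[OF linear_T]]) (auto intro: u)
  \<comment> \<open>That \<open>d\<close> is polynomial along the line is read off from a diagonal
    entry of the product in \<open>B_mult_T\<close>.\<close>
  have "poly_fun (\<lambda>t. (B (u t) ** T (veronese (u t))) $ 1 $ 1)"
    by (simp add: matrix_matrix_mult_def B_def)
      (intro poly_fun_sum poly_fun_mult poly_fun_add poly_fun_const u N)
  then have "poly_fun (\<lambda>t. d (u t))"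
    by (simp add: B_mult_T mat_def)
  moreover have "poly_fun (\<lambda>t. p (c *m T (veronese (u t))))"
    by (rule hom_poly_poly_fun[OF assms(1)]) (auto intro: N)
  moreover have "u 1 = w" "u 0 = v"
    by (simp_all add: u_def vec_eq_iff)
  ultimately show ?thesis
    using poly_fun_mult_eq_0[of "\<lambda>t. p (c *m T (veronese (u t)))" "\<lambda>t. d (u t)" 1 0] assms(2) w
    by force
qed

text \<open>The right-hand side is closed, and by \<open>hom_poly_eq_0\<close> every form vanishing
  at its points with \<open>d v \<noteq> 0\<close> vanishes on all of it, so no smaller closed set
  contains those points.\<close>

lemma reciprocal_surface_range_B:
  "reciprocal_surface (range B) = {cmat.span {T (veronese v)} | v. v \<noteq> 0}"
  unfolding reciprocal_surface_def Proj_inverses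
proof (rule hull_unique)
  have "v \<noteq> 0" if "d v \<noteq> 0" for v
    using that det_B_eq_0_iff[of v] by (auto simp: B_def det_3)
  then show "{cmat.span {T (veronese v)} | v. d v \<noteq> 0} \<subseteq> {cmat.span {T (veronese v)} | v. v \<noteq> 0}"
    by blast
next
  show "zariski_closed {cmat.span {T (veronese v)} | v. v \<noteq> 0}"
    by (rule zariski_closed_T_veronese)
next
  fix Z assume Z: "{cmat.span {T (veronese v)} | v. d v \<noteq> 0} \<subseteq> Z" "zariski_closed Z"
  have "cmat.span {T (veronese v)} \<in> Z" if "v \<noteq> 0" for v
  proof (rule span_mem_zariski_closed[OF Z(2)])
    show "T (veronese v) \<in> Sym3" "T (veronese v) \<noteq> 0"
      using that by (simp_all add: T_veronese_eq_0_iff T_Sym3 veronese_Sym3)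
  next
    fix p e c
    assume p: "hom_poly e p" and vanish: "\<And>P M. P \<in> Z \<Longrightarrow> M \<in> P \<Longrightarrow> p M = 0"
    have "p (c *m T (veronese w)) = 0" if "d w \<noteq> 0" for w
    proof (rule vanish)
      show "cmat.span {T (veronese w)} \<in> Z"
        using Z(1) that by blast
      show "c *m T (veronese w) \<in> cmat.span {T (veronese w)}"
        by (intro cmat.span_scale cmat.span_base) simp
    qed
    then show "p (c *m T (veronese v)) = 0"
      by (rule hom_poly_eq_0[OF p])
  qed
  then show "{cmat.span {T (veronese v)} | v. v \<noteq> 0} \<subseteq> Z" by blast
qed

lemma reciprocal_surface_equivalent_veronese:
  "projectively_equivalent (reciprocal_surface (cmat.span {B\<^sub>1, B\<^sub>2, B\<^sub>3})) veronese_surface"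
  unfolding span_eq_range_B reciprocal_surface_range_B by (rule projectively_equivalent_T_veronese)

end

section \<open>Congruent nets\<close>

lemma mult_cancel_inverse:
  fixes A B C :: "complex^3^3"
  shows "A ** B = mat 1 \<Longrightarrow> A ** (B ** C) = C"
  by (simp add: matrix_mul_assoc)

lemma linear_congruence: "Vector_Spaces.linear (*m) (*m) (\<lambda>M. g ** M ** h)"
  by unfold_locales
    (simp_all add: mscale_matrix_mult matrix_add_ldistrib matrix_add_rdistrib)

lemma congruence_Sym3: "M \<in> Sym3 \<Longrightarrow> g ** M ** transpose g \<in> Sym3"
  by (simp add: Sym3_def matrix_transpose_mul matrix_mul_assoc)

text \<open>Inverting \<open>transpose h ** A ** h\<close> turns the inverse of \<open>A\<close>
  into its conjugate by \<open>g\<close> and \<open>transpose g\<close>, so \<open>T\<close> is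
  followed by that automorphism of \<open>Sym3\<close>, and \<open>d\<close> stays the same.\<close>

lemma reciprocal_param_congruent:
  assumes "reciprocal_param T S B\<^sub>1 B\<^sub>2 B\<^sub>3 d" and gh: "g ** h = mat 1" "h ** g = mat 1"
  shows "reciprocal_param (\<lambda>M. g ** T M ** transpose g) (\<lambda>M. S (h ** M ** transpose h))
    (transpose h ** B\<^sub>1 ** h) (transpose h ** B\<^sub>2 ** h) (transpose h ** B\<^sub>3 ** h) d"
proof -
  interpret reciprocal_param T S B\<^sub>1 B\<^sub>2 B\<^sub>3 d by (rule assms)
  have tr: "transpose h ** transpose g = mat 1" "transpose g ** transpose h = mat 1"
    using gh by (simp_all flip: matrix_transpose_mul)
  \<comment> \<open>Products are reassociated to the right below, so each cancellation is also
    needed with a trailing factor.\<close>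
  note cancel = gh tr mult_cancel_inverse[OF gh(1)] mult_cancel_inverse[OF gh(2)]
    mult_cancel_inverse[OF tr(1)] mult_cancel_inverse[OF tr(2)]
  have 1: "h ** (g ** M ** transpose g) ** transpose h = M"
    and 2: "g ** (h ** M ** transpose h) ** transpose g = M"
    and 3: "(transpose h ** M ** h) ** (g ** N ** transpose g) = transpose h ** (M ** N) ** transpose g"
    for M N
    by (simp_all add: cancel flip: matrix_mul_assoc)
  interpret h: Vector_Spaces.linear "(*m)" "(*m)" "\<lambda>M. transpose h ** M ** h"
    by (rule linear_congruence)
  show ?thesis
  proof
    fix v
    show "(v$1 *m (transpose h ** B\<^sub>1 ** h) + v$2 *m (transpose h ** B\<^sub>2 ** h)
      + v$3 *m (transpose h ** B\<^sub>3 ** h)) ** (g ** T (veronese v) ** transpose g) = d v *m mat 1"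
      unfolding h.add[symmetric] h.scale[symmetric] 3 mult_T
      by (simp add: mscale_matrix_mult tr)
  next
    show "\<exists>w. d w \<noteq> 0" by (rule regular)
  qed (auto simp: 1 2 S_T T_S T_Sym3 S_Sym3 congruence_Sym3 mscale_matrix_mult T.scale S.scale
      T.add S.add matrix_add_ldistrib matrix_add_rdistrib)
qed

text \<open>The inverse congruence carries the standard span back to \<open>L\<close>, and its
  parametrisation with it.\<close>

lemma congruent_span_equivalent_veronese:
  assumes "reciprocal_param T S B\<^sub>1 B\<^sub>2 B\<^sub>3 d" and "congruent_nets L (cmat.span {B\<^sub>1, B\<^sub>2, B\<^sub>3})"
  shows "projectively_equivalent (reciprocal_surface L) veronese_surface"
proof -
  obtain g where g: "invertible g" "cmat.span {B\<^sub>1, B\<^sub>2, B\<^sub>3} = (\<lambda>M. transpose g ** M ** g) ` L"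
    using assms(2) unfolding congruent_nets_def by blast
  then obtain h where gh: "g ** h = mat 1" "h ** g = mat 1"
    unfolding invertible_def by blast
  have tr: "transpose h ** transpose g = mat 1"
    using gh(1) by (simp flip: matrix_transpose_mul)
  have inv: "transpose h ** (transpose g ** M ** g) ** h = M" for M
    by (simp add: gh(1) mult_cancel_inverse[OF tr] flip: matrix_mul_assoc)
  interpret c: Vector_Spaces.linear "(*m)" "(*m)" "\<lambda>M. transpose h ** M ** h"
    by (rule linear_congruence)
  have "L = (\<lambda>M. transpose h ** M ** h) ` cmat.span {B\<^sub>1, B\<^sub>2, B\<^sub>3}"
    unfolding g(2) using inv by (simp add: image_image)
  also have "\<dots> = cmat.span ((\<lambda>M. transpose h ** M ** h) ` {B\<^sub>1, B\<^sub>2, B\<^sub>3})"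
    by (rule c.span_image[symmetric])
  finally have "L = cmat.span {transpose h ** B\<^sub>1 ** h, transpose h ** B\<^sub>2 ** h, transpose h ** B\<^sub>3 ** h}"
    by simp
  then show ?thesis
    using reciprocal_param.reciprocal_surface_equivalent_veronese[OF
      reciprocal_param_congruent[OF assms(1) gh]] by simp
qed

section \<open>The four types\<close>

definition sym_matrix :: "complex \<Rightarrow> complex \<Rightarrow> complex \<Rightarrow> complex \<Rightarrow> complex \<Rightarrow> complex \<Rightarrow> complex^3^3"
  where "sym_matrix a b c d e f = vector [vector [a, d, e], vector [d, b, f], vector [e, f, c]]"

lemma form_matrix_sym_matrix:
  assumes "\<And>x y z. q x y z = a*x^2 + b*y^2 + c*z^2 + 2*d*x*y + 2*e*x*z + 2*f*y*z"
  shows "form_matrix q = sym_matrix a b c d e f"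
proof -
  have "q = (\<lambda>x y z. a*x^2 + b*y^2 + c*z^2 + 2*d*x*y + 2*e*x*z + 2*f*y*z)"
    by (intro ext assms)
  then show ?thesis
    using form_matrix_eq sym_matrix_def by simp
qed

lemma sym_matrix_nth [simp]:
  "sym_matrix a b c d e f $ 1 $ 1 = a" "sym_matrix a b c d e f $ 1 $ 2 = d"
  "sym_matrix a b c d e f $ 1 $ 3 = e" "sym_matrix a b c d e f $ 2 $ 1 = d"
  "sym_matrix a b c d e f $ 2 $ 2 = b" "sym_matrix a b c d e f $ 2 $ 3 = f"
  "sym_matrix a b c d e f $ 3 $ 1 = e" "sym_matrix a b c d e f $ 3 $ 2 = f"
  "sym_matrix a b c d e f $ 3 $ 3 = c"
  by (simp_all add: sym_matrix_def)

lemma sym_matrix_Sym3: "sym_matrix a b c d e f \<in> Sym3"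
  by (simp add: Sym3_nth forall_3)

lemma sym_matrix_add:
  "sym_matrix a b c d e f + sym_matrix a' b' c' d' e' f'
    = sym_matrix (a + a') (b + b') (c + c') (d + d') (e + e') (f + f')"
  by (simp add: vec_eq_iff forall_3)

lemma mscale_sym_matrix:
  "k *m sym_matrix a b c d e f = sym_matrix (k * a) (k * b) (k * c) (k * d) (k * e) (k * f)"
  by (simp add: vec_eq_iff forall_3)

lemma sym_matrix_entries:
  assumes "M \<in> Sym3"
  shows "sym_matrix (M$1$1) (M$2$2) (M$3$3) (M$1$2) (M$1$3) (M$2$3) = M"
proof -
  have "M$2$1 = M$1$2" "M$3$1 = M$1$3" "M$3$2 = M$2$3"
    using assms unfolding Sym3_nth by blast+
  then show ?thesis
    by (simp add: vec_eq_iff forall_3)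
qed

text \<open>A product of symmetric matrices need not be symmetric, hence nine scalar
  equations.\<close>

lemma sym_matrix_mult_eq_mscale_1:
  assumes "a * a' + d * d' + e * e' = k" "a * d' + d * b' + e * f' = 0" "a * e' + d * f' + e * c' = 0"
    "d * a' + b * d' + f * e' = 0" "d * d' + b * b' + f * f' = k" "d * e' + b * f' + f * c' = 0"
    "e * a' + f * d' + c * e' = 0" "e * d' + f * b' + c * f' = 0" "e * e' + f * f' + c * c' = k"
  shows "sym_matrix a b c d e f ** sym_matrix a' b' c' d' e' f' = k *m mat 1"
  using assms by (simp add: vec_eq_iff forall_3 matrix_matrix_mult_def sum_3 mat_def)

lemmas sym_matrix_simps = sym_matrix_add mscale_sym_matrix

text \<open>The constant \<open>c\<close> may vanish here, so that type \<open>B\<^sup>*\<close> is the case \<open>c = 0\<close>, \<open>g = 1\<close>. The map \<open>T\<close> is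
  read off from the adjugate, and \<open>m\<close> recovers the entry \<open>M$3$3\<close> from \<open>T M\<close>.\<close>

lemma reciprocal_param_A:
  fixes c g :: complex
  assumes "c \<noteq> - 9 * g^2"
  shows "\<exists>T S d. reciprocal_param T S
    (sym_matrix 0 1 0 0 1 0) (sym_matrix 0 0 0 0 0 1) (sym_matrix (-1) (-2*g) c 0 g 0) d"
proof -
  define T where "T M = sym_matrix (c * M$1$3 - 2 * g * c * M$3$3 - M$2$2)
      (- M$1$1 - 2 * g * M$1$3 - (c + g^2) * M$3$3) (2 * g * M$3$3 - M$1$3)
      (M$1$2 + g * M$2$3) (g * M$1$3 + 2 * g^2 * M$3$3 - M$1$1) (M$2$3)" for M :: "complex^3^3"
  define m where "m N = (N$1$3 - N$2$2 + 3 * g * N$3$3) / (c + 9 * g^2)" for N :: "complex^3^3"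
  \<comment> \<open>Solves the triangular system \<open>T M = N\<close>: first \<open>M$3$3\<close>
    as \<open>m N\<close>, then \<open>M$1$3\<close> from \<open>N$3$3\<close>, then
    \<open>M$1$1\<close> from \<open>N$1$3\<close>, and \<open>M$2$2\<close> from
    \<open>N$1$1\<close>, where the terms in \<open>m N\<close> cancel.\<close>
  define S where "S N = sym_matrix (g * (2 * g * m N - N$3$3) + 2 * g^2 * m N - N$1$3)
      (- N$1$1 - c * N$3$3) (m N) (N$1$2 - g * N$2$3) (2 * g * m N - N$3$3) (N$2$3)" for N :: "complex^3^3"
  define d where "d v = - v$3 * ((v$1 - 2 * g * v$3) * c * v$3 - v$2^2)
      - (v$1 + g * v$3)^2 * (v$1 - 2 * g * v$3)" for v :: "complex^3"
  have nz: "c + 9 * g^2 \<noteq> 0"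
    using assms by (auto simp: add_eq_0_iff2)
  \<comment> \<open>This combination eliminates \<open>M$1$1\<close> and \<open>M$1$3\<close>; the
    remaining coefficient is where the hypothesis on \<open>c\<close> and \<open>g\<close>
    enters.\<close>
  have "(T M)$1$3 - (T M)$2$2 + 3 * g * (T M)$3$3 = (c + 9 * g^2) * M$3$3" for M
    by (simp add: T_def algebra_simps power2_eq_square)
  then have m_T: "m (T M) = M$3$3" for M
    using nz by (simp add: m_def)
  have m_mult: "(c + 9 * g^2) * m N = N$1$3 - N$2$2 + 3 * g * N$3$3" for N
    using nz by (simp add: m_def)
  have m_linear: "m (M + N) = m M + m N" "m (k *m M) = k * m M" for M N k
    by (simp_all add: m_def add_divide_distrib[symmetric] algebra_simps)
  have "reciprocal_param T S
    (sym_matrix 0 1 0 0 1 0) (sym_matrix 0 0 0 0 0 1) (sym_matrix (-1) (-2*g) c 0 g 0) d"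
  proof
    have "S (T M) = sym_matrix (M$1$1) (M$2$2) (M$3$3) (M$1$2) (M$1$3) (M$2$3)" for M
      unfolding S_def m_T by (simp add: T_def algebra_simps)
    then show "S (T M) = M" if "M \<in> Sym3" for M
      using sym_matrix_entries[OF that] by simp
    \<comment> \<open>The left side is the (2,2) entry of \<open>T (S N)\<close>, the one entry that
      depends on the value of \<open>m N\<close>.\<close>
    have "- (g * (2 * g * m N - N$3$3) + 2 * g^2 * m N - N$1$3) - 2 * g * (2 * g * m N - N$3$3)
        - (c + g^2) * m N = N$2$2" for N
      using m_mult[of N] by (simp add: algebra_simps power2_eq_square)
    then have "T (S N) = sym_matrix (N$1$1) (N$2$2) (N$3$3) (N$1$2) (N$1$3) (N$2$3)" for N
      unfolding S_def T_def by (simp add: algebra_simps)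
    then show "T (S N) = N" if "N \<in> Sym3" for N
      using sym_matrix_entries[OF that] by simp
    show "(v$1 *m sym_matrix 0 1 0 0 1 0 + v$2 *m sym_matrix 0 0 0 0 0 1
        + v$3 *m sym_matrix (-1) (-2*g) c 0 g 0) ** T (veronese v) = d v *m mat 1" for v
      unfolding T_def sym_matrix_simps
      by (rule sym_matrix_mult_eq_mscale_1; simp add: d_def algebra_simps power2_eq_square)
    \<comment> \<open>The first generator is itself invertible.\<close>
    show "\<exists>w. d w \<noteq> 0"
      by (rule exI[of _ "vector [1, 0, 0]"]) (simp add: d_def)
  qed (simp_all add: T_def S_def m_linear sym_matrix_Sym3 sym_matrix_simps algebra_simps)
  then show ?thesis by blast
qed

text \<open>The first map is again read off from the adjugate. It is an involution on
  \<open>Sym3\<close>, so the inverse is given by the same formula.\<close>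

lemma reciprocal_param_D:
  "reciprocal_param
    (\<lambda>M. sym_matrix (- M$2$2) (- M$1$1) (- M$3$3) (M$1$2 - M$3$3) (M$2$3) (M$1$3))
    (\<lambda>N. sym_matrix (- N$2$2) (- N$1$1) (- N$3$3) (N$1$2 - N$3$3) (N$2$3) (N$1$3))
    (sym_matrix 0 0 0 0 1 0) (sym_matrix 0 0 0 0 0 1) (sym_matrix 0 0 1 1 0 0)
    (\<lambda>v. 2 * v$1 * v$2 * v$3 - v$3^3)"
proof
  show "\<exists>w::complex^3. 2 * w$1 * w$2 * w$3 - w$3^3 \<noteq> 0"
    by (rule exI[of _ "vector [0, 0, 1]"]) simp
next
  fix v
  show "(v$1 *m sym_matrix 0 0 0 0 1 0 + v$2 *m sym_matrix 0 0 0 0 0 1 + v$3 *m sym_matrix 0 0 1 1 0 0)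
    ** sym_matrix (- veronese v$2$2) (- veronese v$1$1) (- veronese v$3$3)
      (veronese v$1$2 - veronese v$3$3) (veronese v$2$3) (veronese v$1$3)
    = (2 * v$1 * v$2 * v$3 - v$3^3) *m mat 1"
    unfolding sym_matrix_simps
    by (rule sym_matrix_mult_eq_mscale_1; simp add: algebra_simps power3_eq_cube)
qed (simp_all add: sym_matrix_Sym3 sym_matrix_simps sym_matrix_entries algebra_simps)

text \<open>As for type D*, but here the adjugate map only permutes the six coordinates up to
  sign.\<close>

lemma reciprocal_param_E:
  "reciprocal_param
    (\<lambda>M. sym_matrix (- M$2$2) (- M$1$1) (- M$3$3) (M$1$2) (M$2$3) (M$1$3))
    (\<lambda>N. sym_matrix (- N$2$2) (- N$1$1) (- N$3$3) (N$1$2) (N$2$3) (N$1$3))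
    (sym_matrix 0 0 0 0 1 0) (sym_matrix 0 0 0 0 0 1) (sym_matrix 0 0 0 1 0 0)
    (\<lambda>v. 2 * v$1 * v$2 * v$3)"
proof
  \<comment> \<open>Each generator is singular, so all three coordinates must be nonzero.\<close>
  show "\<exists>w::complex^3. 2 * w$1 * w$2 * w$3 \<noteq> 0"
    by (rule exI[of _ "vector [1, 1, 1]"]) simp
next
  fix v
  show "(v$1 *m sym_matrix 0 0 0 0 1 0 + v$2 *m sym_matrix 0 0 0 0 0 1 + v$3 *m sym_matrix 0 0 0 1 0 0)
    ** sym_matrix (- veronese v$2$2) (- veronese v$1$1) (- veronese v$3$3)
      (veronese v$1$2) (veronese v$2$3) (veronese v$1$3)
    = (2 * v$1 * v$2 * v$3) *m mat 1"
    unfolding sym_matrix_simps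
    by (rule sym_matrix_mult_eq_mscale_1; simp add: algebra_simps)
qed (simp_all add: sym_matrix_Sym3 sym_matrix_simps sym_matrix_entries algebra_simps)

theorem theorem3p2:
  fixes L :: "(complex^3^3) set"
  assumes "is_net L"
    and "type_A L \<or> type_B_star L \<or> type_D_star L \<or> type_E_star L"
  shows "projectively_equivalent (reciprocal_surface L) veronese_surface"
proof -
  \<comment> \<open>The entry \<open>-2*1\<close> keeps the shape \<open>-2*g\<close>, so that the
    third generator of type B* matches the family of type A at \<open>g = 1\<close>.\<close>
  have f: "form_matrix (\<lambda>x y z. y^2 + 2*x*z) = sym_matrix 0 1 0 0 1 0"
      "form_matrix (\<lambda>x y z. 2*y*z) = sym_matrix 0 0 0 0 0 1"
      "form_matrix (\<lambda>x y z. 2*x*z) = sym_matrix 0 0 0 0 1 0"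
      "form_matrix (\<lambda>x y z. 2*x*y) = sym_matrix 0 0 0 1 0 0"
      "form_matrix (\<lambda>x y z. z^2 + 2*x*y) = sym_matrix 0 0 1 1 0 0"
      "form_matrix (\<lambda>x y z. - (x^2) - 2*y^2 + 2*x*z) = sym_matrix (-1) (-2*1) 0 0 1 0"
      "form_matrix (\<lambda>x y z. - (x^2) - 2*g*y^2 + c*z^2 + 2*g*x*z) = sym_matrix (-1) (-2*g) c 0 g 0"
    for c g
    by (rule form_matrix_sym_matrix; simp)+
  have A: "projectively_equivalent (reciprocal_surface L) veronese_surface"
    if "c \<noteq> - 9 * g^2" and "congruent_nets L
      (cmat.span {sym_matrix 0 1 0 0 1 0, sym_matrix 0 0 0 0 0 1, sym_matrix (-1) (-2*g) c 0 g 0})"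
    for c g
    using reciprocal_param_A[OF that(1)] congruent_span_equivalent_veronese[OF _ that(2)] by blast
  from assms(2) consider "type_A L" | "type_B_star L" | "type_D_star L" | "type_E_star L"
    by blast
  then show ?thesis
  proof cases
    case 1
    then show ?thesis unfolding type_A_def f using A by blast
  next
    case 2
    then show ?thesis unfolding type_B_star_def f by (intro A[of 0 1]) auto
  next
    case 3
    then show ?thesis unfolding type_D_star_def f
      by (rule congruent_span_equivalent_veronese[OF reciprocal_param_D])
  next
    case 4
    then show ?thesis unfolding type_E_star_def f
      by (rule congruent_span_equivalent_veronese[OF reciprocal_param_E])
  qed
qed

end
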